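(* Let $0\le v_1<\cdots<v_n$ be real numbers, let $J\subset\{1,\ldots,n\}$, and let $(J_+,J_-)$ be a partition of $J$. Every tuple $\bar x(J)$ generated by the greedy procedure, for any ordering $j_1,\ldots,j_m$ of the elements of $J$, is a $J$-circuit that is undominated with respect to $(J_+,J_-)$.
   Context: For $J\subset\{1,\ldots,n\}$, a $J$-circuit is a tuple $x(J)=(x_j)_{j\in J}$ of pairwise distinct values from $\{v_1,\ldots,v_n\}$ that creates no cycle: there are no $k\ge 1$ and distinct $i_1,\ldots,i_k\in J$ with $x_{i_t}=v_{i_{t+1}}$ for $t=1,\ldots,k-1$ and $x_{i_k}=v_{i_1}$. For a partition $(J_+,J_-)$ of $J$ (parts may be empty), $x(J)$ dominates $y(J)$ with respect to $(J_+,J_-)$ if $x_j\le y_j$ for all $j\in J_+$ and $x_j\ge y_j$ for all $j\in J_-$. A $J$-circuit is undominated with respect to $(J_+,J_-)$ if no other $J$-circuit dominates it with respect to $(J_+,J_-)$. Greedy procedure for an ordering $j_1,\ldots,j_m$ of the elements of $J$: for $i=1,\ldots,m$ in turn, given $\bar x_{j_1},\ldots,\bar x_{j_{i-1}}$, let $\bar x_{j_i}$ be the minimum (if $j_i\in J_+$) or the maximum (if $j_i\in J_-$) among those values in $\{v_1,\ldots,v_n\}\setminus\{\bar x_{j_1},\ldots,\bar x_{j_{i-1}}\}$ for which $(\bar x_{j_1},\ldots,\bar x_{j_i})$ is a $J'$-circuit, where $J'=\{j_1,\ldots,j_i\}$. (If at some step no such value exists, which can only occur when $J=\{1,\ldots,n\}$,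 no tuple is generated.) The generated tuple is $\bar x(J)=(\bar x_j)_{j\in J}$. *)

theory Defs
  imports Complex_Main "HOL-Library.FuncSet"
begin

text \<open>A tuple indexed by \<open>J\<close> is an extensional function on \<open>J\<close> (it takes the value
  \<^term>\<open>undefined\<close> outside \<open>J\<close>), so that equality of tuples is equality of functions.\<close>

definition creates_cycle :: "(nat \<Rightarrow> real) \<Rightarrow> nat set \<Rightarrow> (nat \<Rightarrow> real) \<Rightarrow> bool" where
  "creates_cycle v J x \<longleftrightarrow>
     (\<exists>k\<ge>1. \<exists>i :: nat \<Rightarrow> nat. inj_on i {1..k} \<and> i ` {1..k} \<subseteq> J \<and>
        (\<forall>t\<in>{1..<k}. x (i t) = v (i (t + 1))) \<and> x (i k) = v (i 1))"

definition J_circuit :: "nat \<Rightarrow> (nat \<Rightarrow> real) \<Rightarrow> nat set \<Rightarrow> (nat \<Rightarrow> real) \<Rightarrow> bool" where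
  "J_circuit n v J x \<longleftrightarrow>
     x \<in> J \<rightarrow>\<^sub>E v ` {1..n} \<and> inj_on x J \<and> \<not> creates_cycle v J x"

definition dominates :: "nat set \<Rightarrow> nat set \<Rightarrow> (nat \<Rightarrow> real) \<Rightarrow> (nat \<Rightarrow> real) \<Rightarrow> bool" where
  "dominates Jp Jm x y \<longleftrightarrow> (\<forall>j\<in>Jp. x j \<le> y j) \<and> (\<forall>j\<in>Jm. x j \<ge> y j)"

definition undominated ::
  "nat \<Rightarrow> (nat \<Rightarrow> real) \<Rightarrow> nat set \<Rightarrow> nat set \<Rightarrow> nat set \<Rightarrow> (nat \<Rightarrow> real) \<Rightarrow> bool" where
  "undominated n v J Jp Jm x \<longleftrightarrow>
     \<not> (\<exists>y. J_circuit n v J y \<and> y \<noteq> x \<and> dominates Jp Jm y x)"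

definition candidates ::
  "nat \<Rightarrow> (nat \<Rightarrow> real) \<Rightarrow> nat set \<Rightarrow> (nat \<Rightarrow> real) \<Rightarrow> nat \<Rightarrow> real set" where
  "candidates n v D x j =
     {c \<in> v ` {1..n} - x ` D. J_circuit n v (insert j D) (x(j := c))}"

text \<open>In \<open>greedy_from n v Jp D x js\<close>, the set \<open>D\<close> consists of the indices already processed,
  \<open>x\<close> is the tuple built so far (indexed by \<open>D\<close>), and \<open>js\<close> lists the indices still to be
  processed, in order; those outside \<open>Jp\<close> belong to the part on which maxima are taken. The
  result is \<^term>\<open>None\<close> if at some step there is no admissible value.\<close>

fun greedy_from ::
  "nat \<Rightarrow> (nat \<Rightarrow> real) \<Rightarrow> nat set \<Rightarrow> nat set \<Rightarrow> (nat \<Rightarrow> real) \<Rightarrow> nat list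
     \<Rightarrow> (nat \<Rightarrow> real) option" where
  "greedy_from n v Jp D x [] = Some x"
| "greedy_from n v Jp D x (j # js) =
     (let C = candidates n v D x j in
      if C = {} then None
      else greedy_from n v Jp (insert j D) (x(j := (if j \<in> Jp then Min C else Max C))) js)"

definition greedy ::
  "nat \<Rightarrow> (nat \<Rightarrow> real) \<Rightarrow> nat set \<Rightarrow> nat list \<Rightarrow> (nat \<Rightarrow> real) option" where
  "greedy n v Jp js = greedy_from n v Jp {} (\<lambda>_. undefined) js"

end

theory Submission
  imports Defs
begin

text \<open>Admissible values extend a circuit to a circuit, so the greedy tuple is a circuit by
  construction; the point is that it is undominated.

  Circuits are closed under restricting the index set: a cycle in the restricted tuple would
  already be a cycle in the whole one. This is the only structural property of circuits behind
  this. Suppose a circuit \<open>y\<close> dominates the greedy tuple \<open>x\<close>, and that the two differ; let \<open>j\<close>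
  be the first index, in the order of the procedure, at which they do. Restricting \<open>y\<close> to the
  indices up to \<open>j\<close> gives a circuit that extends the values chosen by the procedure before \<open>j\<close>, so
  \<open>y j\<close> is one of the admissible values from which \<open>x j\<close> was selected
  (\<open>circuit_value_is_candidate\<close>). The extremal choice makes \<open>x j\<close> at least as good as \<open>y j\<close>,
  domination gives the converse, and hence \<open>y j = x j\<close>, a contradiction. In the induction below
  (\<open>greedy_from_unique\<close>) this takes the positive form that agreement of \<open>y\<close> with the tuple built so
  far propagates from each step to the next.\<close>

lemma creates_cycle_mono:
  assumes "creates_cycle v D x" and "D \<subseteq> J" and "\<And>j. j \<in> D \<Longrightarrow> x j = y j"
  shows "creates_cycle v J y"
proof -
  from assms(1) obtain k :: nat and i :: "nat \<Rightarrow> nat" where ki: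
      "k \<ge> 1" "inj_on i {1..k}" "i ` {1..k} \<subseteq> D"
      "\<forall>t\<in>{1..<k}. x (i t) = v (i (t + 1))" "x (i k) = v (i 1)"
    unfolding creates_cycle_def by blast
  have eq: "y (i t) = x (i t)" if "t \<in> {1..k}" for t
  proof -
    have "i t \<in> D" using that ki(3) by auto
    then show ?thesis using assms(3) by simp
  qed
  have "\<forall>t\<in>{1..<k}. y (i t) = v (i (t + 1))" "y (i k) = v (i 1)"
    using ki eq by auto
  moreover have "i ` {1..k} \<subseteq> J" using ki(3) assms(2) by (rule subset_trans)
  ultimately show ?thesis
    unfolding creates_cycle_def using ki(1,2) by (intro exI[of _ k] exI[of _ i] conjI)
qed

lemma J_circuit_restrict:
  assumes "J_circuit n v J y" and "D \<subseteq> J"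
  shows "J_circuit n v D (restrict y D)"
proof -
  have "\<not> creates_cycle v D (restrict y D)"
    using assms creates_cycle_mono[of v D "restrict y D" J y] by (auto simp: J_circuit_def)
  moreover have "inj_on (restrict y D) D"
    using assms by (auto simp: J_circuit_def inj_on_def)
  ultimately show ?thesis
    using assms by (auto simp: J_circuit_def)
qed

lemma finite_candidates: "finite (candidates n v D x j)"
  by (simp add: candidates_def)

text \<open>The greedy step loses nothing: every circuit extending the partial tuple takes at \<open>j\<close> a value
  that the procedure considers there.\<close>

lemma circuit_value_is_candidate:
  assumes y: "J_circuit n v J y" and sub: "insert j D \<subseteq> J" and "j \<notin> D"
    and x: "x \<in> extensional D" and eq: "\<And>i. i \<in> D \<Longrightarrow> y i = x i"
  shows "y j \<in> candidates n v D x j"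
proof -
  have "x(j := y j) = restrict y (insert j D)"
    using x eq by (auto simp: fun_eq_iff extensional_def)
  then have "J_circuit n v (insert j D) (x(j := y j))"
    using J_circuit_restrict[OF y sub] by simp
  moreover have "y j \<in> v ` {1..n}"
    using y sub by (auto simp: J_circuit_def)
  moreover have "y j \<notin> x ` D"
  proof
    assume "y j \<in> x ` D"
    then obtain i where "i \<in> D" "y j = y i" using eq by auto
    then show False
      using y sub \<open>j \<notin> D\<close> by (auto simp: J_circuit_def dest!: inj_onD)
  qed
  ultimately show ?thesis by (simp add: candidates_def)
qed

lemma greedy_choice_is_candidate:
  assumes "C = candidates n v D x j" and "C \<noteq> {}"
  shows "(if P then Min C else Max C) \<in> C"
  using assms finite_candidates[of n v D x j] Min_in[of C] Max_in[of C] by simp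

lemma greedy_from_J_circuit:
  assumes "greedy_from n v Jp D x js = Some z" and "J_circuit n v D x"
  shows "J_circuit n v (D \<union> set js) z"
  using assms
proof (induction js arbitrary: D x)
  case (Cons j js)
  define C where "C = candidates n v D x j"
  define c where "c = (if j \<in> Jp then Min C else Max C)"
  from Cons.prems(1) have "C \<noteq> {}"
      and rest: "greedy_from n v Jp (insert j D) (x(j := c)) js = Some z"
    by (auto simp: C_def c_def Let_def split: if_splits)
  then have "c \<in> C"
    unfolding c_def using greedy_choice_is_candidate[OF C_def] by blast
  then have "J_circuit n v (insert j D) (x(j := c))"
    by (simp add: C_def candidates_def)
  from Cons.IH[OF rest this] show ?case by simp
qed simp

lemma greedy_from_keeps_values:
  assumes "greedy_from n v Jp D x js = Some z" and "i \<notin> set js"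
  shows "z i = x i"
  using assms by (induction js arbitrary: D x) (auto simp: Let_def split: if_splits)

text \<open>The requirement on \<open>y\<close> concerns only the indices still to be processed; on those already
  processed, equality takes the place of domination.\<close>

lemma greedy_from_unique:
  assumes "greedy_from n v Jp D x js = Some z" and "J_circuit n v D x"
    and "distinct js" and "set js \<inter> D = {}"
    and "J_circuit n v (D \<union> set js) y"
    and "\<And>i. i \<in> D \<Longrightarrow> y i = x i"
    and "\<And>i. i \<in> set js \<Longrightarrow> if i \<in> Jp then y i \<le> z i else z i \<le> y i"
  shows "y = z"
  using assms
proof (induction js arbitrary: D x)
  case Nil
  then have "y \<in> extensional D" "z \<in> extensional D" "\<And>i. i \<in> D \<Longrightarrow> y i = z i"
    by (auto simp: J_circuit_def PiE_def)
  then show ?case by (rule extensionalityI)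
next
  case (Cons j js)
  define C where "C = candidates n v D x j"
  define c where "c = (if j \<in> Jp then Min C else Max C)"
  from Cons.prems(1) have "C \<noteq> {}"
      and rest: "greedy_from n v Jp (insert j D) (x(j := c)) js = Some z"
    by (auto simp: C_def c_def Let_def split: if_splits)
  then have "c \<in> C"
    unfolding c_def using greedy_choice_is_candidate[OF C_def] by blast
  then have circ: "J_circuit n v (insert j D) (x(j := c))"
    by (simp add: C_def candidates_def)
  have "x \<in> extensional D"
    using Cons.prems(2) by (auto simp: J_circuit_def PiE_def)
  then have "y j \<in> C"
    unfolding C_def using Cons.prems(4,6)
    by (intro circuit_value_is_candidate[OF Cons.prems(5)]) auto
  then have "if j \<in> Jp then c \<le> y j else y j \<le> c"
    using finite_candidates[of n v D x j] by (auto simp: c_def C_def)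
  moreover have "z j = c"
    using greedy_from_keeps_values[OF rest, of j] Cons.prems(3) by simp
  ultimately have "y j = c"
    using Cons.prems(7)[of j] by (auto split: if_splits)
  then show ?case
    using Cons.prems by (intro Cons.IH[OF rest circ]) auto
qed

theorem theorem8:
  fixes n :: nat and v :: "nat \<Rightarrow> real"
    and J Jp Jm :: "nat set" and js :: "nat list" and x :: "nat \<Rightarrow> real"
  assumes "\<forall>i\<in>{1..n}. 0 \<le> v i"
    and "strict_mono_on {1..n} v"
    and "J \<subseteq> {1..n}"
    and "Jp \<union> Jm = J" and "Jp \<inter> Jm = {}"
    and "distinct js" and "set js = J"
    and "greedy n v Jp js = Some x"
  shows "J_circuit n v J x \<and> undominated n v J Jp Jm x"
proof
  have empty: "J_circuit n v {} (\<lambda>_. undefined)"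
    by (auto simp: J_circuit_def creates_cycle_def)
  have run: "greedy_from n v Jp {} (\<lambda>_. undefined) js = Some x"
    using assms(8) by (simp add: greedy_def)
  show "J_circuit n v J x"
    using greedy_from_J_circuit[OF run empty] assms(7) by simp
  have "y = x" if "J_circuit n v J y" and "dominates Jp Jm y x" for y
  proof (rule greedy_from_unique[OF run empty])
    show "if i \<in> Jp then y i \<le> x i else x i \<le> y i" if "i \<in> set js" for i
      using that \<open>dominates Jp Jm y x\<close> assms(4,7) by (auto simp: dominates_def)
  qed (use that assms(6,7) in auto)
  then show "undominated n v J Jp Jm x"
    by (auto simp: undominated_def)
qed

end
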